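(* Let $(R^\alpha)_{\alpha\in(0,1)}$ be a generalized quantile function and, for $X\in \mathrm{B}_{\mathrm b}$, let \[ \varrho(X):=\inf\Big(\big\{\alpha\in(0,1)\,\big|\, R^\alpha(X)\le 0\big\}\cup\{1\}\Big). \] Then $\varrho\colon \mathrm{B}_{\mathrm b}\to[0,1]$ is a default risk measure and $R^\alpha=\mathrm{VaR}_\varrho^\alpha$ for all $\alpha\in(0,1)$.
   Context: $(\Omega,\mathcal F)$ is a measurable space ($\Omega\neq\emptyset$) and $\mathrm{B}_{\mathrm b}$ is the space of all bounded measurable functions $\Omega\to\mathbb{R}$, ordered pointwise; real constants are identified with constant functions. A map $R\colon \mathrm{B}_{\mathrm b}\to\mathbb{R}$ is a monetary risk measure if (i) $R(X)\le R(Y)$ whenever $X\le Y$, and (ii) $R(0)=0$ and $R(X+m)=R(X)+m$ for all $X\in \mathrm{B}_{\mathrm b}$, $m\in\mathbb{R}$. A map $\varrho\colon \mathrm{B}_{\mathrm b}\to[0,1]$ is a default risk measure if (i) $\varrho(X)\le\varrho(Y)$ whenever $X\le Y$, and (ii) $\varrho(0)=0$ and $\varrho(m)=1$ for all real $m>0$. For a default risk measure $\varrho$ and $\alpha\in(0,1)$, the $\varrho$-value at risk at level $\alpha$ is \[ \mathrm{VaR}_\varrho^\alpha(X):=\inf\{m\in\mathbb{R}\mid \varrho(X-m)\le\alpha\},\quad X\in \mathrm{B}_{\mathrm b}. \] A generalized quantile function is a family $(R^\alpha)_{\alpha\in(0,1)}$ such that (i) $R^\alpha\colon \mathrm{B}_{\mathrm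 b}\to\mathbb{R}$ is a monetary risk measure for each $\alpha\in(0,1)$; (ii) $R^\beta(X)\le R^\alpha(X)$ for all $X\in \mathrm{B}_{\mathrm b}$ and $\alpha,\beta\in(0,1)$ with $\alpha\le\beta$; (iii) $R^\alpha(X)=\sup_{\beta\in(\alpha,1)}R^\beta(X)$ for all $\alpha\in(0,1)$ and $X\in \mathrm{B}_{\mathrm b}$. *)

theory Defs
  imports "HOL-Analysis.Analysis"
begin

text \<open>
  A measurable space is represented by a \<open>'a measure\<close> \<open>M\<close>, of which only \<open>space M\<close> and \<open>sets M\<close>
  matter. Elements of \<open>bdd_measurable M\<close> are total functions whose values outside \<open>space M\<close> are
  irrelevant: the order only looks at \<open>space M\<close>, so a functional that is monotone with respect to
  it takes equal values on functions that agree on \<open>space M\<close>.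
\<close>

definition bdd_measurable :: "'a measure \<Rightarrow> ('a \<Rightarrow> real) set" where
  "bdd_measurable M = {X \<in> borel_measurable M. bounded (X ` space M)}"

definition le_on_space :: "'a measure \<Rightarrow> ('a \<Rightarrow> real) \<Rightarrow> ('a \<Rightarrow> real) \<Rightarrow> bool" where
  "le_on_space M X Y \<longleftrightarrow> (\<forall>\<omega>\<in>space M. X \<omega> \<le> Y \<omega>)"

definition monetary_risk_measure :: "'a measure \<Rightarrow> (('a \<Rightarrow> real) \<Rightarrow> real) \<Rightarrow> bool" where
  "monetary_risk_measure M R \<longleftrightarrow>
     (\<forall>X\<in>bdd_measurable M. \<forall>Y\<in>bdd_measurable M. le_on_space M X Y \<longrightarrow> R X \<le> R Y) \<and>
     R (\<lambda>_. 0) = 0 \<and>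
     (\<forall>X\<in>bdd_measurable M. \<forall>m. R (\<lambda>\<omega>. X \<omega> + m) = R X + m)"

definition default_risk_measure :: "'a measure \<Rightarrow> (('a \<Rightarrow> real) \<Rightarrow> real) \<Rightarrow> bool" where
  "default_risk_measure M \<rho> \<longleftrightarrow>
     (\<forall>X\<in>bdd_measurable M. \<rho> X \<in> {0..1}) \<and>
     (\<forall>X\<in>bdd_measurable M. \<forall>Y\<in>bdd_measurable M. le_on_space M X Y \<longrightarrow> \<rho> X \<le> \<rho> Y) \<and>
     \<rho> (\<lambda>_. 0) = 0 \<and>
     (\<forall>m>0. \<rho> (\<lambda>_. m) = 1)"

text \<open>
  For a default risk measure, \<open>\<alpha> \<in> {0<..<1}\<close> and \<open>X \<in> bdd_measurable M\<close> with \<open>space M \<noteq> {}\<close>,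
  the set below is nonempty (it contains every upper bound of \<open>X\<close>) and bounded below (by every
  lower bound of \<open>X\<close>), so the real-valued infimum is the genuine one.
\<close>

definition VaR :: "(('a \<Rightarrow> real) \<Rightarrow> real) \<Rightarrow> real \<Rightarrow> ('a \<Rightarrow> real) \<Rightarrow> real" where
  "VaR \<rho> \<alpha> X = Inf {m. \<rho> (\<lambda>\<omega>. X \<omega> - m) \<le> \<alpha>}"

text \<open>
  The supremum in the last clause is over a nonempty set that is bounded above by \<open>R \<alpha> X\<close>, by
  the second clause.
\<close>

definition generalized_quantile_function ::
    "'a measure \<Rightarrow> (real \<Rightarrow> ('a \<Rightarrow> real) \<Rightarrow> real) \<Rightarrow> bool" where
  "generalized_quantile_function M R \<longleftrightarrow>
     (\<forall>\<alpha>\<in>{0<..<1}. monetary_risk_measure M (R \<alpha>)) \<and>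
     (\<forall>X\<in>bdd_measurable M. \<forall>\<alpha>\<in>{0<..<1}. \<forall>\<beta>\<in>{0<..<1}. \<alpha> \<le> \<beta> \<longrightarrow> R \<beta> X \<le> R \<alpha> X) \<and>
     (\<forall>\<alpha>\<in>{0<..<1}. \<forall>X\<in>bdd_measurable M. R \<alpha> X = (SUP \<beta>\<in>{\<alpha><..<1}. R \<beta> X))"

end

theory Submission
  imports Defs
begin

text \<open>
  Right-continuity of the family in the level makes the sublevel sets correspond:
  \<open>\<rho> X \<le> \<alpha>\<close> iff \<open>R \<alpha> X \<le> 0\<close>. Applied to \<open>X - m\<close>, cash additivity turns the set defining
  \<open>VaR \<rho> \<alpha> X\<close> into the half-line \<open>{R \<alpha> X..}\<close>.
\<close>

lemma const_bdd_measurable: "(\<lambda>_. c) \<in> bdd_measurable M"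
proof -
  have "(\<lambda>_. c) ` space M \<subseteq> {c}"
    by auto
  then have "bounded ((\<lambda>_. c) ` space M)"
    by (metis bounded_subset finite.emptyI finite.insertI finite_imp_bounded)
  then show ?thesis
    by (simp add: bdd_measurable_def)
qed

lemma shift_bdd_measurable:
  assumes "X \<in> bdd_measurable M"
  shows "(\<lambda>\<omega>. X \<omega> + c) \<in> bdd_measurable M"
proof -
  have "bounded ((\<lambda>\<omega>. X \<omega> + c) ` space M)"
    using assms const_bdd_measurable[of c M]
    by (intro bounded_plus_comp) (auto simp: bdd_measurable_def)
  then show ?thesis
    using assms by (auto simp: bdd_measurable_def)
qed

lemma monetary_risk_measure_const:
  assumes "monetary_risk_measure M R"
  shows "R (\<lambda>_. c) = c"
proof -
  have "\<forall>X\<in>bdd_measurable M. R (\<lambda>\<omega>. X \<omega> + c) = R X + c"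
    using assms by (simp add: monetary_risk_measure_def)
  from bspec[OF this const_bdd_measurable[of 0]] show ?thesis
    using assms by (simp add: monetary_risk_measure_def)
qed

text \<open>The element 1 keeps the set nonempty when no level satisfies
  \<open>f \<alpha> \<le> 0\<close>, so \<open>Inf\<close> is a genuine infimum of a subset of
  \<open>{0..1}\<close>.\<close>

lemma Inf_levels_bounds:
  fixes f :: "real \<Rightarrow> real"
  shows "Inf ({\<alpha> \<in> {0<..<1}. f \<alpha> \<le> 0} \<union> {1}) \<in> {0..1}"
proof -
  have "bdd_below ({\<alpha> \<in> {0<..<1}. f \<alpha> \<le> 0} \<union> {1})"
    by (rule bdd_belowI[of _ 0]) auto
  then show ?thesis
    by (auto intro!: cInf_greatest intro: cInf_lower)
qed

text \<open>The levels with \<open>R \<alpha> X \<le> 0\<close> are upward closed in the open unit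
  interval because \<open>R\<close> decreases in the level. Hence an infimum at most
  \<open>\<alpha>\<close> gives \<open>R \<beta> X \<le> 0\<close> for every \<open>\<beta>\<close>
  strictly above \<open>\<alpha>\<close>, and the supremum formula carries this over to
  \<open>\<alpha>\<close> itself.\<close>

lemma Inf_levels_le_iff:
  assumes R: "generalized_quantile_function M R"
    and X: "X \<in> bdd_measurable M" and \<alpha>: "\<alpha> \<in> {0<..<1}"
  shows "Inf ({\<alpha> \<in> {0<..<1}. R \<alpha> X \<le> 0} \<union> {1}) \<le> \<alpha> \<longleftrightarrow> R \<alpha> X \<le> 0"
    (is "Inf ?S \<le> \<alpha> \<longleftrightarrow> _")
proof
  assume "R \<alpha> X \<le> 0"
  moreover have "bdd_below ?S"
    by (rule bdd_belowI[of _ 0]) auto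
  ultimately show "Inf ?S \<le> \<alpha>"
    using \<alpha> by (intro cInf_lower) auto
next
  assume le: "Inf ?S \<le> \<alpha>"
  have "R \<beta> X \<le> 0" if \<beta>: "\<beta> \<in> {\<alpha><..<1}" for \<beta>
  proof -
    have "Inf ?S < \<beta>"
      using le \<beta> by auto
    then obtain \<gamma> where "\<gamma> \<in> ?S" "\<gamma> < \<beta>"
      using cInf_lessD[of ?S \<beta>] by auto
    \<comment> \<open>The adjoined element 1 is excluded as a value of \<open>\<gamma>\<close>,
      since \<open>\<gamma> < \<beta> < 1\<close>.\<close>
    then have \<gamma>: "\<gamma> \<in> {0<..<1}" "R \<gamma> X \<le> 0" "\<gamma> \<le> \<beta>"
      using \<beta> by auto
    have "\<beta> \<in> {0<..<1}"
      using \<alpha> \<beta> by auto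
    then have "R \<beta> X \<le> R \<gamma> X"
      using R X \<gamma> unfolding generalized_quantile_function_def by blast
    then show ?thesis
      using \<gamma> by simp
  qed
  then have "(SUP \<beta>\<in>{\<alpha><..<1}. R \<beta> X) \<le> 0"
    using \<alpha> by (intro cSUP_least) auto
  moreover have "R \<alpha> X = (SUP \<beta>\<in>{\<alpha><..<1}. R \<beta> X)"
    using R X \<alpha> unfolding generalized_quantile_function_def by blast
  ultimately show "R \<alpha> X \<le> 0"
    by simp
qed

theorem theorem19:
  fixes M :: "'a measure"
    and R :: "real \<Rightarrow> ('a \<Rightarrow> real) \<Rightarrow> real"
    and \<rho> :: "('a \<Rightarrow> real) \<Rightarrow> real"
  assumes "space M \<noteq> {}"
    and "generalized_quantile_function M R"
    and "\<And>X. X \<in> bdd_measurable M \<Longrightarrow> \<rho> X = Inf ({\<alpha> \<in> {0<..<1}. R \<alpha> X \<le> 0} \<union> {1})"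
  shows "default_risk_measure M \<rho> \<and>
    (\<forall>\<alpha>\<in>{0<..<1}. \<forall>X\<in>bdd_measurable M. R \<alpha> X = VaR \<rho> \<alpha> X)"
proof (intro conjI ballI)
  have monetary: "monetary_risk_measure M (R \<alpha>)" if "\<alpha> \<in> {0<..<1}" for \<alpha>
    using assms(2) that unfolding generalized_quantile_function_def by blast
  have le_iff: "\<rho> X \<le> \<alpha> \<longleftrightarrow> R \<alpha> X \<le> 0" if "X \<in> bdd_measurable M" "\<alpha> \<in> {0<..<1}" for X \<alpha>
    using Inf_levels_le_iff[OF assms(2) that] assms(3)[OF that(1)] by simp
  have bounds: "\<rho> X \<in> {0..1}" if "X \<in> bdd_measurable M" for X
    unfolding assms(3)[OF that] by (rule Inf_levels_bounds)
  have mono: "\<rho> X \<le> \<rho> Y"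
    if XY: "X \<in> bdd_measurable M" "Y \<in> bdd_measurable M" "le_on_space M X Y" for X Y
  \<comment> \<open>It suffices to bound \<open>\<rho> X\<close> by every \<open>\<alpha>\<close>
    above \<open>\<rho> Y\<close>. Such an \<open>\<alpha>\<close> is positive as
    \<open>\<rho> Y \<ge> 0\<close>; if it is also below 1, \<open>le_iff\<close> reduces the claim
    to monotonicity of \<open>R \<alpha>\<close>, and otherwise \<open>\<rho> X \<le> 1\<close> is
    enough.\<close>
  proof (rule dense_ge)
    fix \<alpha> assume \<alpha>: "\<rho> Y < \<alpha>"
    show "\<rho> X \<le> \<alpha>"
    proof (cases "\<alpha> < 1")
      case True
      then have \<alpha>01: "\<alpha> \<in> {0<..<1}"
        using bounds[OF XY(2)] \<alpha> by auto
      have "R \<alpha> X \<le> R \<alpha> Y"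
        using monetary[OF \<alpha>01] XY unfolding monetary_risk_measure_def by blast
      then show ?thesis
        using le_iff[OF XY(1) \<alpha>01] le_iff[OF XY(2) \<alpha>01] \<alpha> by simp
    next
      case False
      then show ?thesis
        using bounds[OF XY(1)] by simp
    qed
  qed
  have zero: "\<rho> (\<lambda>_. 0) = 0"
  proof (rule antisym)
    show "\<rho> (\<lambda>_. 0) \<le> 0"
      \<comment> \<open>Each \<open>R \<alpha>\<close> vanishes at 0, so \<open>\<rho>\<close> at 0
        is at most every level strictly between 0 and 1.\<close>
      by (rule dense_ge_bounded[of 0 1])
        (auto simp: le_iff const_bdd_measurable monetary_risk_measure_const[OF monetary])
  qed (use bounds[OF const_bdd_measurable] in auto)
  have pos: "\<rho> (\<lambda>_. m) = 1" if "m > 0" for m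
  proof -
    \<comment> \<open>Every \<open>R \<alpha>\<close> takes the value \<open>m > 0\<close> here, so
      only the adjoined 1 is left in the infimum.\<close>
    have "{\<alpha> \<in> {0<..<1}. R \<alpha> (\<lambda>_. m) \<le> 0} = {}"
      using that by (auto simp: monetary_risk_measure_const[OF monetary])
    then show ?thesis
      by (simp only: assms(3)[OF const_bdd_measurable]) simp
  qed
  show "default_risk_measure M \<rho>"
    unfolding default_risk_measure_def using bounds mono zero pos by blast
  fix \<alpha> :: real and X
  assume \<alpha>: "\<alpha> \<in> {0<..<1}" and X: "X \<in> bdd_measurable M"
  have "\<rho> (\<lambda>\<omega>. X \<omega> - m) \<le> \<alpha> \<longleftrightarrow> R \<alpha> X \<le> m" for m
  proof -
    \<comment> \<open>The difference is written as the sum with \<open>- m\<close> to match the form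
      of cash additivity and of \<open>shift_bdd_measurable\<close>.\<close>
    have "R \<alpha> (\<lambda>\<omega>. X \<omega> + - m) = R \<alpha> X + - m"
      using monetary[OF \<alpha>] X unfolding monetary_risk_measure_def by blast
    then show ?thesis
      using le_iff[OF shift_bdd_measurable[OF X, of "- m"] \<alpha>] by simp
  qed
  then have "{m. \<rho> (\<lambda>\<omega>. X \<omega> - m) \<le> \<alpha>} = {R \<alpha> X..}"
    by auto
  then show "R \<alpha> X = VaR \<rho> \<alpha> X"
    by (simp add: VaR_def)
qed

end
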